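(* Let $k\geq 2$ and let $d_1,\dots,d_k\geq 3$ be integers. The tensor rank of $W_{d_1}\otimes\cdots\otimes W_{d_k}\in\bigotimes_{i=1}^k(\mathbb{C}^2)^{\otimes d_i}$ is at most $2^{k-1}(d_1+\cdots+d_k-2k+2)$.
   Context: All vector spaces are over $\mathbb{C}$. Let $e_1,e_2$ be a basis of $\mathbb{C}^2$. For a positive integer $d$, the (generalized) $W$-state is $$W_d=\sum_{i=1}^d e_1^{\otimes (i-1)}\otimes e_2\otimes e_1^{\otimes(d-i)}\in(\mathbb{C}^2)^{\otimes d}.$$ The rank of a tensor $T\in\bigotimes_{i=1}^k(\mathbb{C}^2)^{\otimes d_i}=(\mathbb{C}^2)^{\otimes(d_1+\cdots+d_k)}$ is the minimum integer $r$ such that $T$ is a sum of $r$ elementary tensors $v_1\otimes\cdots\otimes v_{d_1+\cdots+d_k}$ with $v_j\in\mathbb{C}^2$. *)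

theory Defs
  imports "HOL-Analysis.Analysis"
begin

text \<open>A tensor in the n-th tensor power of \<open>\<complex>\<^sup>2\<close> is represented by its array of coordinates: a
  function on multi-indices (lists over the two-element type \<open>2\<close>, which indexes \<open>complex ^ 2\<close>),
  set to zero off the multi-indices of length n.\<close>

type_synonym tensor = "2 list \<Rightarrow> complex"

definition tensor_space :: "nat \<Rightarrow> tensor set" where
  "tensor_space n = {T. \<forall>I. length I \<noteq> n \<longrightarrow> T I = 0}"

definition elementary_tensor :: "(complex ^ 2) list \<Rightarrow> tensor" where
  "elementary_tensor vs = (\<lambda>I. if length I = length vs
     then (\<Prod>j<length vs. (vs ! j) $ (I ! j)) else 0)"

text \<open>The product of a tensor of degree m with a tensor of arbitrary degree.\<close>

definition tensor_mult :: "nat \<Rightarrow> tensor \<Rightarrow> tensor \<Rightarrow> tensor" where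
  "tensor_mult m S T = (\<lambda>I. S (take m I) * T (drop m I))"

definition is_sum_of_elementary :: "nat \<Rightarrow> nat \<Rightarrow> tensor \<Rightarrow> bool" where
  "is_sum_of_elementary n r T \<longleftrightarrow>
     (\<exists>V :: nat \<Rightarrow> (complex ^ 2) list. (\<forall>s<r. length (V s) = n) \<and>
        T = (\<lambda>I. \<Sum>s<r. elementary_tensor (V s) I))"

text \<open>For n > 0 the minimum exists for every element of \<open>tensor_space n\<close>,
  see \<open>tensor_rank_attained\<close> below.\<close>

definition tensor_rank :: "nat \<Rightarrow> tensor \<Rightarrow> nat" where
  "tensor_rank n T = (LEAST r. is_sum_of_elementary n r T)"

definition W_state :: "complex ^ 2 \<Rightarrow> complex ^ 2 \<Rightarrow> nat \<Rightarrow> tensor" where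
  "W_state e1 e2 d = (\<lambda>I. \<Sum>i=1..d.
     elementary_tensor (replicate (i - 1) e1 @ [e2] @ replicate (d - i) e1) I)"

text \<open>The product of the W-states of degrees \<open>d\<^sub>1, \<dots>, d\<^sub>k\<close>, the degrees being given as a list. The
  empty product \<open>elementary_tensor []\<close> is the scalar 1, the unit of \<open>tensor_mult\<close>.\<close>

primrec W_product :: "complex ^ 2 \<Rightarrow> complex ^ 2 \<Rightarrow> nat list \<Rightarrow> tensor" where
  "W_product e1 e2 [] = elementary_tensor []"
| "W_product e1 e2 (d # ds) = tensor_mult d (W_state e1 e2 d) (W_product e1 e2 ds)"

lemma prod_lessThan_add:
  fixes f :: "nat \<Rightarrow> 'a::comm_monoid_mult"
  shows "(\<Prod>j<m + n. f j) = (\<Prod>j<m. f j) * (\<Prod>j<n. f (m + j))"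
  by (induction n) (simp_all add: mult.assoc)

lemma tensor_mult_elementary:
  "tensor_mult (length us) (elementary_tensor us) (elementary_tensor vs)
     = elementary_tensor (us @ vs)"
proof
  fix I :: "2 list"
  let ?m = "length us" and ?n = "length vs"
  show "tensor_mult ?m (elementary_tensor us) (elementary_tensor vs) I
     = elementary_tensor (us @ vs) I"
  proof (cases "length I = ?m + ?n")
    case True
    have "(\<Prod>j<?m + ?n. ((us @ vs) ! j) $ (I ! j)) =
      (\<Prod>j<?m. ((us @ vs) ! j) $ (I ! j)) * (\<Prod>j<?n. ((us @ vs) ! (?m + j)) $ (I ! (?m + j)))"
      by (rule prod_lessThan_add)
    then show ?thesis
      using True
      by (simp add: tensor_mult_def elementary_tensor_def nth_append)
  qed (auto simp: tensor_mult_def elementary_tensor_def)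
qed

lemma elementary_tensor_in_space: "elementary_tensor vs \<in> tensor_space (length vs)"
  by (simp add: elementary_tensor_def tensor_space_def)

lemma W_state_in_space: "W_state e1 e2 d \<in> tensor_space d"
  by (auto simp: W_state_def tensor_space_def elementary_tensor_def intro!: sum.neutral)

lemma tensor_mult_in_space:
  assumes "S \<in> tensor_space m" "T \<in> tensor_space n"
  shows "tensor_mult m S T \<in> tensor_space (m + n)"
  unfolding tensor_space_def
proof safe
  fix I :: "2 list"
  assume "length I \<noteq> m + n"
  then have "length (take m I) \<noteq> m \<or> length (drop m I) \<noteq> n" by auto
  then show "tensor_mult m S T I = 0"
    using assms unfolding tensor_mult_def tensor_space_def by auto
qed

lemma W_product_in_space: "W_product e1 e2 ds \<in> tensor_space (sum_list ds)"
proof (induction ds)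
  case Nil
  show ?case using elementary_tensor_in_space[of "[]"] by simp
next
  case (Cons d ds)
  then show ?case using tensor_mult_in_space[OF W_state_in_space] by simp
qed

lemma is_sum_of_elementary_exists:
  assumes "n > 0" "T \<in> tensor_space n"
  shows "\<exists>r. is_sum_of_elementary n r T"
proof -
  let ?L = "{J :: 2 list. length J = n}"
  have fin: "finite ?L" using finite_lists_length_eq[of "UNIV :: 2 set" n] by simp
  obtain h where h: "bij_betw h {..<card ?L} ?L"
    using ex_bij_betw_nat_finite[OF fin] by (auto simp: lessThan_atLeast0)
  define V where "V J = (T J *s axis (hd J) 1) # map (\<lambda>i. axis i 1) (tl J)" for J
  have len: "length (V J) = n" if "J \<in> ?L" for J using that assms(1) by (simp add: V_def)
  have val: "elementary_tensor (V J) I = (if I = J then T J else 0)"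
    if J: "J \<in> ?L" for I J
  proof (cases "length I = n")
    case True
    obtain m where n: "n = Suc m" using assms(1) by (cases n) auto
    obtain a J' where J': "J = a # J'" "length J' = m" using J n by (cases J) auto
    obtain b I' where I': "I = b # I'" "length I' = m" using True n by (cases I) auto
    have "elementary_tensor (V J) I =
      (T J * (if b = a then 1 else 0)) * (\<Prod>j<m. if I' ! j = J' ! j then 1 else 0)"
      using J' I' by (simp add: elementary_tensor_def V_def prod.lessThan_Suc_shift axis_def
          cong: if_cong del: prod.lessThan_Suc)
    also have "(\<Prod>j<m. if I' ! j = J' ! j then 1 else 0) = (if I' = J' then 1 else 0 :: complex)"
      using J' I' by (auto simp: prod_zero_iff list_eq_iff_nth_eq)
    finally show ?thesis using J' I' by simp
  next
    case False
    then show ?thesis using J len[OF J] by (auto simp: elementary_tensor_def)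
  qed
  have "T I = (\<Sum>s<card ?L. elementary_tensor (V (h s)) I)" for I
  proof -
    have "(\<Sum>s<card ?L. elementary_tensor (V (h s)) I) = (\<Sum>J\<in>?L. elementary_tensor (V J) I)"
      by (rule sum.reindex_bij_betw[OF h])
    also have "\<dots> = (\<Sum>J\<in>?L. if I = J then T J else 0)" by (rule sum.cong) (auto simp: val)
    also have "\<dots> = T I" using fin assms(2) by (auto simp: sum.delta' tensor_space_def)
    finally show ?thesis by simp
  qed
  moreover have "\<forall>s<card ?L. length (V (h s)) = n"
    using len h by (auto simp: bij_betw_def)
  ultimately have "is_sum_of_elementary n (card ?L) T"
    unfolding is_sum_of_elementary_def by (intro exI[of _ "\<lambda>s. V (h s)"]) auto
  then show ?thesis ..
qed

lemma tensor_rank_attained: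
  assumes "n > 0" "T \<in> tensor_space n"
  shows "is_sum_of_elementary n (tensor_rank n T) T"
  using is_sum_of_elementary_exists[OF assms] unfolding tensor_rank_def by (rule LeastI_ex)

end

theory Submission
  imports Defs "HOL-Computational_Algebra.Polynomial"
begin

text \<open>The coordinates of a W-state are linear coefficients of products of linear polynomials:
  with \<open>q\<^sub>i(s) = \<Prod>\<^sub>j (e1 $ I\<^sub>i\<^sub>j + s * e2 $ I\<^sub>i\<^sub>j)\<close> for the multi-index
  \<open>I\<^sub>i\<close> of the block of degree \<open>d\<^sub>i\<close>, the coordinate of \<open>W\<^bsub>d\<^sub>i\<^esub>\<close> at \<open>I\<^sub>i\<close> is the coefficient
  \<open>[s] q\<^sub>i\<close> of \<open>s\<close> in \<open>q\<^sub>i\<close>, while \<open>q\<^sub>i(s)\<close> itself is a coordinate of the elementary tensor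
  \<open>(e1 + s e2)\<^bsup>\<otimes>d\<^sub>i\<^esup>\<close>. A rank bound is therefore the same kind of thing as a cubature rule: it suffices
  to write the functional \<open>(q\<^sub>1, \<dots>, q\<^sub>k) \<mapsto> \<Prod> [s] q\<^sub>i\<close>, for all polynomials with
  \<open>deg q\<^sub>i \<le> d\<^sub>i\<close>, as a combination of the evaluations \<open>\<Prod> q\<^sub>i(s\<^sub>i)\<close> at few points \<open>s\<close>.

  The points are taken on the \<open>2\<^bsup>k-1\<^esup>\<close> lines \<open>s = (z, \<epsilon>\<^sub>2 z, \<dots>, \<epsilon>\<^sub>k z)\<close> with \<open>\<epsilon>\<^sub>i = \<plusminus>1\<close>. On such a
  line the product of the \<open>q\<^sub>i\<close> becomes a polynomial \<open>R\<^sub>\<epsilon>(z)\<close> of degree at most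
  \<open>D = d\<^sub>1 + \<dots> + d\<^sub>k\<close>. The sum of \<open>\<epsilon>\<^sub>2 \<cdots> \<epsilon>\<^sub>k R\<^sub>\<epsilon>\<close> over all signs is
  \<open>q\<^sub>1(z) \<Prod> (q\<^sub>i(z) - q\<^sub>i(-z))\<close>, where the product over \<open>i \<ge> 2\<close> is \<open>z\<^bsup>k-1\<^esup>\<close> times an even
  polynomial; so its coefficient of \<open>z\<^sup>k\<close> is the wanted number up to the factor \<open>2\<^bsup>k-1\<^esup>\<close>
  (\<open>prod_odd_parts\<close>).

  It remains to read off \<open>[z\<^sup>k] R\<^sub>\<epsilon>\<close> with only \<open>N = D - 2 k + 2\<close> evaluations per line.
  A weighted average over the \<open>N\<close> solutions of \<open>z\<^sup>N = c\<close> returns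
  \<open>[z\<^sup>k] R\<^sub>\<epsilon> + c [z\<^bsup>k+N\<^esup>] R\<^sub>\<epsilon>\<close> (\<open>average_over_root_coset\<close>); no other coefficient
  survives, because \<open>d\<^sub>i \<ge> 3\<close> gives \<open>D \<ge> 3 k\<close> and hence \<open>k < N\<close>. The second term is an error,
  but \<open>c\<close> may depend on the line. For \<open>c = \<Prod>\<^bsub>i\<ge>2\<^esub> \<epsilon>\<^sub>i\<^bsup>d\<^sub>i\<^esup>\<close> the errors add up to the
  coefficient of \<open>z\<^bsup>k+N\<^esup>\<close> in \<open>q\<^sub>1(z) \<Prod> (q\<^sub>i(z) - (-1)\<^bsup>d\<^sub>i\<^esup> q\<^sub>i(-z))\<close>. There each of the \<open>k - 1\<close> last
  factors has lost its term of degree \<open>d\<^sub>i\<close>, so the degree is at most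
  \<open>D - k + 1 < k + N\<close> and the errors cancel (\<open>degree_prod_cancelled\<close>).\<close>

section \<open>Averages over cosets of roots of unity\<close>

lemma sum_powers_root_coset:
  fixes \<rho> :: complex
  assumes "0 < N"
  shows "(\<Sum>j<N. (\<rho> * exp (2 * of_real pi * \<i> * of_nat j / of_nat N)) ^ m)
    = (if N dvd m then of_nat N * \<rho> ^ m else 0)"
proof -
  define \<zeta> where "\<zeta> = exp (2 * of_real pi * \<i> * of_nat m / of_nat N)"
  have pow: "exp (2 * of_real pi * \<i> * of_nat j / of_nat N) ^ m = \<zeta> ^ j" for j
    unfolding \<zeta>_def by (simp flip: exp_of_nat_mult add: mult_ac)
  have one: "\<zeta> = 1 \<longleftrightarrow> N dvd m"
    unfolding \<zeta>_def using complex_root_unity_eq_1[of N m] assms by simp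
  have root: "\<zeta> ^ N = 1"
    unfolding \<zeta>_def using complex_root_unity[of N m] assms by simp
  have "(\<Sum>j<N. \<zeta> ^ j) = (if N dvd m then of_nat N else 0)"
    using one root geometric_sum[of \<zeta> N] by auto
  then show ?thesis
    by (simp add: power_mult_distrib pow flip: sum_distrib_left)
qed

lemma poly_eq_sum_lessThan:
  fixes p :: "'a::comm_semiring_1 poly"
  assumes "degree p < m"
  shows "poly p x = (\<Sum>i<m. coeff p i * x ^ i)"
  unfolding poly_altdef
  by (rule sum.mono_neutral_left) (use assms in \<open>auto simp: coeff_eq_0\<close>)

text \<open>The average kills every coefficient whose index is not congruent to \<open>k\<close> modulo \<open>N\<close>; the
  degree bound leaves only the indices \<open>k\<close> and \<open>k + N\<close>. The weight \<open>\<omega>\<^bsup>N-k\<^esup> / c\<close> is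
  \<open>\<omega>\<^bsup>-k\<^esup>\<close>, as \<open>\<omega>\<^sup>N = c\<close>.\<close>

lemma average_over_root_coset:
  fixes R :: "complex poly"
  assumes "k < N" "\<rho> ^ N = c" "c \<noteq> 0" "degree R < k + 2 * N"
  defines "\<omega> \<equiv> (\<lambda>j. \<rho> * exp (2 * of_real pi * \<i> * of_nat j / of_nat N))"
  shows "(\<Sum>j<N. \<omega> j ^ (N - k) / (c * of_nat N) * poly R (\<omega> j))
    = coeff R k + c * coeff R (k + N)"
proof -
  let ?f = "\<lambda>a. coeff R a * (if N dvd N - k + a then \<rho> ^ (N - k + a) / c else 0)"
  have N: "0 < N" using assms(1) by simp
  have "(\<Sum>j<N. \<omega> j ^ (N - k) / (c * of_nat N) * poly R (\<omega> j))
      = (\<Sum>j<N. \<Sum>a<k + 2 * N. coeff R a / (c * of_nat N) * \<omega> j ^ (N - k + a))"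
    unfolding poly_eq_sum_lessThan[OF assms(4)]
    by (simp add: sum_distrib_left power_add mult_ac)
  also have "\<dots> = (\<Sum>a<k + 2 * N. coeff R a / (c * of_nat N) * (\<Sum>j<N. \<omega> j ^ (N - k + a)))"
    unfolding sum_distrib_left by (rule sum.swap)
  also have "\<dots> = (\<Sum>a<k + 2 * N. ?f a)"
    unfolding \<omega>_def sum_powers_root_coset[OF N] using N
    by (intro sum.cong) auto
  also have "\<dots> = (\<Sum>a\<in>{k, k + N}. ?f a)"
  proof (rule sum.mono_neutral_right)
    show "\<forall>a\<in>{..<k + 2 * N} - {k, k + N}. ?f a = 0"
    proof
      fix a assume a: "a \<in> {..<k + 2 * N} - {k, k + N}"
      have "\<not> N dvd N - k + a"
      proof
        assume "N dvd N - k + a"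
        then obtain t where t: "N - k + a = N * t" by (auto elim: dvdE)
        have "N * t < N * 3" unfolding t[symmetric] using a assms(1) by auto
        then have "t < 3" by (simp only: mult_less_cancel1)
        moreover have "t \<noteq> 0" using t assms(1) by (intro notI) simp
        ultimately have "t = 1 \<or> t = 2" by auto
        then show False using t a assms(1) by auto
      qed
      then show "?f a = 0" by simp
    qed
  qed (use N in auto)
  also have "\<dots> = coeff R k + c * coeff R (k + N)"
  proof -
    have "N - k + (k + N) = N + N" using assms(1) by simp
    then show ?thesis using N assms(1-3) by (simp add: power_add)
  qed
  finally show ?thesis .
qed

section \<open>Signed sums over reflections of the variables\<close>

definition signs :: "nat \<Rightarrow> complex list set" where
  "signs n = {es. set es \<subseteq> {1, -1} \<and> length es = n}"

lemma finite_signs: "finite (signs n)"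
  unfolding signs_def by (rule finite_lists_length_eq) simp

lemma card_signs: "card (signs n) = 2 ^ n"
  unfolding signs_def by (subst card_lists_length_eq) (auto simp: numeral_2_eq_2)

lemma signs_0: "signs 0 = {[]}"
  by (auto simp: signs_def)

lemma sum_signs_Suc:
  "(\<Sum>es\<in>signs (Suc n). f es) = (\<Sum>es\<in>signs n. f (1 # es)) + (\<Sum>es\<in>signs n. f (- 1 # es))"
proof -
  have "signs (Suc n) = (#) 1 ` signs n \<union> (#) (- 1) ` signs n"
    by (auto simp: signs_def length_Suc_conv)
  moreover have "(#) 1 ` signs n \<inter> (#) (- 1) ` signs n = {}" by auto
  ultimately show ?thesis
    by (simp add: sum.union_disjoint finite_signs sum.reindex)
qed

text \<open>Multiplying out the right-hand side gives one summand for each choice of signs: the sign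
  \<open>1\<close> stands for the term \<open>p(X)\<close> of a factor and the sign \<open>-1\<close> for its term in \<open>p(-X)\<close>. The
  exponents \<open>ms\<close> allow two sign patterns below: all \<open>1\<close> for the main term, and \<open>d + 1\<close> for the
  error term.\<close>

lemma sum_signs_pcompose:
  fixes ps :: "complex poly list" and ms :: "nat list"
  assumes "length ps = length ms"
  shows "(\<Sum>es\<in>signs (length ps). smult (prod_list (map2 power es ms))
      (prod_list (map2 (\<lambda>p e. p \<circ>\<^sub>p [:0, e:]) ps es)))
    = prod_list (map2 (\<lambda>p m. p + smult ((- 1) ^ m) (p \<circ>\<^sub>p [:0, - 1:])) ps ms)"
  using assms
proof (induction ps ms rule: list_induct2)
  case Nil
  then show ?case by (simp add: signs_0)
next
  case (Cons p ps m ms)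
  let ?S = "\<Sum>es\<in>signs (length ps). smult (prod_list (map2 power es ms))
      (prod_list (map2 (\<lambda>p e. p \<circ>\<^sub>p [:0, e:]) ps es))"
  have id: "p \<circ>\<^sub>p [:0, 1:] = p"
    by (rule poly_eqI) (simp add: coeff_pcompose_linear)
  have "(\<Sum>es\<in>signs (length (p # ps)). smult (prod_list (map2 power es (m # ms)))
      (prod_list (map2 (\<lambda>p e. p \<circ>\<^sub>p [:0, e:]) (p # ps) es)))
    = p * ?S + smult ((- 1) ^ m) (p \<circ>\<^sub>p [:0, - 1:]) * ?S"
    by (simp add: sum_signs_Suc id sum_distrib_left mult_ac del: pcompose_pCons)
  then show ?case
    using Cons.IH by (simp add: algebra_simps)
qed

text \<open>Each factor \<open>p(X) - p(-X)\<close> is \<open>X\<close> times an even polynomial with constant term twice the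
  linear coefficient of \<open>p\<close>. Of the evenness of the product \<open>G\<close> only the vanishing of its linear
  coefficient is recorded, which ensures that \<open>q * G\<close> has the linear coefficient
  \<open>coeff q 1 * coeff G 0\<close>.\<close>

lemma prod_odd_parts:
  fixes ps :: "complex poly list"
  obtains G where
    "prod_list (map2 (\<lambda>p m. p + smult ((- 1) ^ m) (p \<circ>\<^sub>p [:0, - 1:])) ps (replicate (length ps) 1))
      = monom 1 (length ps) * G"
    "coeff G 0 = 2 ^ length ps * (\<Prod>p\<leftarrow>ps. coeff p 1)" "coeff G 1 = 0"
proof (induction ps arbitrary: thesis)
  case Nil
  show ?case by (rule Nil[of 1]) auto
next
  case (Cons p ps)
  obtain G where G: "prod_list (map2 (\<lambda>p m. p + smult ((- 1) ^ m) (p \<circ>\<^sub>p [:0, - 1:]))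
        ps (replicate (length ps) 1)) = monom 1 (length ps) * G"
    "coeff G 0 = 2 ^ length ps * (\<Prod>p\<leftarrow>ps. coeff p 1)" "coeff G 1 = 0"
    by (rule Cons.IH)
  obtain a h where h: "p + smult ((- 1) ^ 1) (p \<circ>\<^sub>p [:0, - 1:]) = pCons a h"
    by (metis pCons_cases)
  have coeffs: "coeff (pCons a h) i = coeff p i - (- 1) ^ i * coeff p i" for i
    unfolding h[symmetric] by (simp add: coeff_pcompose_linear)
  have a: "a = 0" using coeffs[of 0] by simp
  have h0: "coeff h 0 = 2 * coeff p 1" using coeffs[of 1] by simp
  have h1: "coeff h 1 = 0" using coeffs[of 2] by (simp add: numeral_2_eq_2)
  have X: "pCons a h = monom 1 1 * h" using a by (simp add: monom_altdef)
  show ?case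
  proof (rule Cons.prems[of "h * G"])
    show "prod_list (map2 (\<lambda>p m. p + smult ((- 1) ^ m) (p \<circ>\<^sub>p [:0, - 1:])) (p # ps)
        (replicate (length (p # ps)) 1)) = monom 1 (length (p # ps)) * (h * G)"
      using G(1) h X by (simp add: mult_ac monom_altdef)
    show "coeff (h * G) 0 = 2 ^ length (p # ps) * (\<Prod>p\<leftarrow>p # ps. coeff p 1)"
      using G(2) h0 by (simp add: coeff_mult_0)
    show "coeff (h * G) 1 = 0"
      using G(3) h1 by (simp add: coeff_mult)
  qed
qed

text \<open>For the exponent \<open>d + 1\<close> the terms of degree \<open>d\<close> cancel, so every factor
  loses one degree.\<close>

lemma degree_prod_cancelled:
  fixes ps :: "complex poly list" and ds :: "nat list"
  assumes "list_all2 (\<lambda>p d. degree p \<le> d) ps ds" "\<forall>d\<in>set ds. 0 < d"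
  shows "degree (prod_list (map2 (\<lambda>p m. p + smult ((- 1) ^ m) (p \<circ>\<^sub>p [:0, - 1:])) ps (map Suc ds)))
    + length ds \<le> sum_list ds"
  using assms
proof (induction ps ds rule: list_all2_induct)
  case Nil
  then show ?case by simp
next
  case (Cons p ps d ds)
  let ?h = "p + smult ((- 1) ^ Suc d) (p \<circ>\<^sub>p [:0, - 1:])"
  have "coeff ?h i = 0" if "i > d - 1" for i
  proof (cases "i = d")
    case True
    then show ?thesis by (simp add: coeff_pcompose_linear flip: power_add mult.assoc)
  next
    case False
    then show ?thesis using that Cons.hyps by (simp add: coeff_pcompose_linear coeff_eq_0)
  qed
  then have "degree ?h \<le> d - 1" by (intro degree_le) auto
  then have "degree ?h + 1 \<le> d" using Cons.prems by auto
  then show ?case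
    using Cons.IH Cons.prems degree_mult_le[of ?h "prod_list (map2 (\<lambda>p m. p + smult ((- 1) ^ m)
      (p \<circ>\<^sub>p [:0, - 1:])) ps (map Suc ds))"]
    by (simp del: power_Suc)
qed

section \<open>A cubature rule\<close>

lemma degree_prod_pcompose:
  assumes "list_all2 (\<lambda>p d. degree p \<le> d) ps ds"
  shows "degree (prod_list (map2 (\<lambda>p e. p \<circ>\<^sub>p [:0, e::complex:]) ps es)) \<le> sum_list ds"
  using assms
proof (induction ps ds arbitrary: es rule: list_all2_induct)
  case Nil
  then show ?case by simp
next
  case (Cons p ps d ds)
  show ?case
  proof (cases es)
    case es: (Cons e es')
    have "degree (p \<circ>\<^sub>p [:0, e:]) \<le> d"
      by (rule degree_le) (use Cons.hyps in \<open>auto simp: coeff_pcompose_linear coeff_eq_0\<close>)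
    then show ?thesis
      using es Cons.IH[of es']
        degree_mult_le[of "p \<circ>\<^sub>p [:0, e:]" "prod_list (map2 (\<lambda>p e. p \<circ>\<^sub>p [:0, e:]) ps es')"]
      by simp
  qed simp
qed

lemma poly_prod_pcompose:
  "poly (prod_list (map2 (\<lambda>p e. p \<circ>\<^sub>p [:0, e:]) ps es)) z
    = prod_list (map2 (\<lambda>p e. poly p (e * z)) ps es)"
  by (induction ps es rule: list_induct2') (simp_all add: poly_pcompose mult.commute)

lemma prod_list_power_ones: "length es = n \<Longrightarrow> prod_list (map2 power es (replicate n 1)) = prod_list es"
  by (induction es arbitrary: n) auto

lemma prod_list_power_Suc:
  "length es = length ds \<Longrightarrow> prod_list (map2 power es (map Suc ds))
    = (prod_list es * prod_list (map2 power es ds) :: complex)"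
  by (induction es ds rule: list_induct2) (auto simp: mult_ac)

lemma prod_list_power_nonzero:
  "set es \<subseteq> {1, - 1} \<Longrightarrow> prod_list (map2 power es ds) \<noteq> (0 :: complex)"
  by (induction es ds rule: list_induct2') auto

text \<open>The index pairs choose a line, by its signs, and a node on it. Weights and nodes do
  not depend on the polynomials, so that later the same vectors serve for all coordinates of a
  tensor. The first polynomial is kept apart because its variable carries no sign: changing all
  signs at once gives the same line.\<close>

lemma linear_coeff_cubature:
  fixes d N :: nat and ds :: "nat list"
  assumes N: "N + 2 * length ds = d + sum_list ds" "length ds + 1 < N"
    and pos: "\<forall>d\<in>set ds. 0 < d"
  obtains w z :: "complex list \<times> nat \<Rightarrow> complex" where
    "\<And>q ps. degree q \<le> d \<Longrightarrow> list_all2 (\<lambda>p d. degree p \<le> d) ps ds \<Longrightarrow>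
      coeff q 1 * (\<Prod>p\<leftarrow>ps. coeff p 1)
        = (\<Sum>x\<in>signs (length ds) \<times> {..<N}. w x *
            (poly q (z x) * prod_list (map2 (\<lambda>p e. poly p (e * z x)) ps (fst x))))"
proof -
  define n where "n = length ds"
  \<comment> \<open>With this value of \<open>z ^ N\<close> the contributions of degree \<open>length ds + 1 + N\<close> cancel.\<close>
  define c where "c es = prod_list (map2 power es ds)" for es :: "complex list"
  define \<rho> where "\<rho> es = exp (Ln (c es) / of_nat N)" for es
  define z where "z x = \<rho> (fst x) * exp (2 * of_real pi * \<i> * of_nat (snd x) / of_nat N)"
    for x :: "complex list \<times> nat"
  define w where "w x = prod_list (fst x) / 2 ^ n * (z x ^ (N - (n + 1)) / (c (fst x) * of_nat N))"
    for x
  have "coeff q 1 * (\<Prod>p\<leftarrow>ps. coeff p 1)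
        = (\<Sum>x\<in>signs (length ds) \<times> {..<N}. w x *
            (poly q (z x) * prod_list (map2 (\<lambda>p e. poly p (e * z x)) ps (fst x))))"
    if q: "degree q \<le> d" and ps: "list_all2 (\<lambda>p d. degree p \<le> d) ps ds" for q ps
  proof -
    have len: "length ps = n" using ps by (simp add: n_def list_all2_lengthD)
    define P where "P es = prod_list (map2 (\<lambda>p e. p \<circ>\<^sub>p [:0, e:]) ps es)" for es
    define Q where "Q ms = prod_list (map2 (\<lambda>p m. p + smult ((- 1) ^ m) (p \<circ>\<^sub>p [:0, - 1:])) ps ms)"
      for ms
    have Q: "(\<Sum>es\<in>signs n. prod_list (map2 power es ms) * coeff (q * P es) i) = coeff (q * Q ms) i"
      if "length ms = n" for ms i
    proof -
      have "Q ms = (\<Sum>es\<in>signs n. smult (prod_list (map2 power es ms)) (P es))"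
        using sum_signs_pcompose[of ps ms] that len by (simp add: P_def Q_def)
      then have "q * Q ms = (\<Sum>es\<in>signs n. smult (prod_list (map2 power es ms)) (q * P es))"
        by (simp add: sum_distrib_left)
      then show ?thesis by (simp add: coeff_sum)
    qed
    \<comment> \<open>Dividing \<open>Q\<close> by \<open>X ^ n\<close> reduces the main term to a linear coefficient.\<close>
    have main: "(\<Sum>es\<in>signs n. prod_list es * coeff (q * P es) (n + 1))
      = 2 ^ n * (coeff q 1 * (\<Prod>p\<leftarrow>ps. coeff p 1))"
    proof -
      obtain G where G: "Q (replicate n 1) = monom 1 n * G"
        "coeff G 0 = 2 ^ n * (\<Prod>p\<leftarrow>ps. coeff p 1)" "coeff G 1 = 0"
        using prod_odd_parts[of ps] unfolding Q_def len by blast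
      have "(\<Sum>es\<in>signs n. prod_list es * coeff (q * P es) (n + 1))
        = coeff (q * Q (replicate n 1)) (n + 1)"
        unfolding Q[of "replicate n 1", OF length_replicate, symmetric]
        by (rule sum.cong) (auto simp: signs_def prod_list_power_ones simp del: One_nat_def)
      also have "q * Q (replicate n 1) = monom 1 n * (q * G)"
        using G(1) by (simp add: mult_ac)
      also have "coeff \<dots> (n + 1) = coeff (q * G) 1"
        by (simp only: coeff_monom_mult) simp
      also have "\<dots> = coeff q 1 * coeff G 0"
        using G(3) by (simp add: coeff_mult)
      finally show ?thesis using G(2) by simp
    qed
    \<comment> \<open>The signs \<open>prod_list es * c es\<close> are those of the exponents \<open>d + 1\<close>.\<close>
    have error: "(\<Sum>es\<in>signs n. prod_list es * (c es * coeff (q * P es) (n + 1 + N))) = 0"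
    proof -
      have "degree (q * Q (map Suc ds)) + n \<le> d + sum_list ds"
        using degree_prod_cancelled[OF ps pos] degree_mult_le[of q "Q (map Suc ds)"] q
        unfolding Q_def n_def by linarith
      then have "degree (q * Q (map Suc ds)) < n + 1 + N"
        using N unfolding n_def by linarith
      then have "0 = coeff (q * Q (map Suc ds)) (n + 1 + N)"
        by (simp add: coeff_eq_0)
      also have "\<dots> = (\<Sum>es\<in>signs n. prod_list es * (c es * coeff (q * P es) (n + 1 + N)))"
        by (subst Q[symmetric])
          (auto simp: n_def c_def signs_def prod_list_power_Suc intro!: sum.cong)
      finally show ?thesis by simp
    qed
    have "2 ^ n * (coeff q 1 * (\<Prod>p\<leftarrow>ps. coeff p 1))
      = (\<Sum>es\<in>signs n. prod_list es * (coeff (q * P es) (n + 1) + c es * coeff (q * P es) (n + 1 + N)))"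
      using main error by (simp add: distrib_left sum.distrib)
    also have "\<dots> = (\<Sum>es\<in>signs n. prod_list es * (\<Sum>j<N. z (es, j) ^ (N - (n + 1)) / (c es * of_nat N)
        * poly (q * P es) (z (es, j))))"
    proof (intro sum.cong refl arg_cong2[where f = "(*)"])
      fix es assume es: "es \<in> signs n"
      have c: "c es \<noteq> 0" using es unfolding c_def signs_def by (simp add: prod_list_power_nonzero)
      have \<rho>: "\<rho> es ^ N = c es"
        using c N(2) unfolding \<rho>_def by (simp flip: exp_of_nat_mult)
      have "degree (q * P es) \<le> d + sum_list ds"
        using degree_mult_le[of q "P es"] q degree_prod_pcompose[OF ps, of es]
        unfolding P_def by linarith
      then have "degree (q * P es) < n + 1 + 2 * N"
        using N unfolding n_def by linarith
      from average_over_root_coset[OF _ \<rho> c this]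
      show "coeff (q * P es) (n + 1) + c es * coeff (q * P es) (n + 1 + N)
        = (\<Sum>j<N. z (es, j) ^ (N - (n + 1)) / (c es * of_nat N) * poly (q * P es) (z (es, j)))"
        using N(2) by (simp add: n_def z_def)
    qed
    also have "\<dots> = 2 ^ n * (\<Sum>es\<in>signs n. \<Sum>j<N. w (es, j) * poly (q * P es) (z (es, j)))"
      by (simp add: sum_distrib_left w_def mult_ac)
    also have "\<dots> = 2 ^ n * (\<Sum>x\<in>signs n \<times> {..<N}. w x * poly (q * P (fst x)) (z x))"
      by (simp add: sum.cartesian_product case_prod_unfold)
    finally show ?thesis
      by (simp add: P_def poly_prod_pcompose n_def)
  qed
  then show ?thesis by (rule that)
qed

section \<open>Coordinates of W-states\<close>

lemma elementary_tensor_Nil [simp]: "elementary_tensor [] [] = 1"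
  by (simp add: elementary_tensor_def)

lemma elementary_tensor_Cons_Nil [simp]: "elementary_tensor (v # vs) [] = 0"
  by (simp add: elementary_tensor_def)

lemma elementary_tensor_Cons [simp]:
  "elementary_tensor (v # vs) (i # I) = v $ i * elementary_tensor vs I"
  by (simp add: elementary_tensor_def prod.lessThan_Suc_shift del: prod.lessThan_Suc)

text \<open>The coordinate at \<open>I\<close> of the tensor power of \<open>e1 + s e2\<close>, as a polynomial in \<open>s\<close>.\<close>

definition coordinate_poly :: "complex ^ 2 \<Rightarrow> complex ^ 2 \<Rightarrow> 2 list \<Rightarrow> complex poly" where
  "coordinate_poly e1 e2 I = (\<Prod>i\<leftarrow>I. [:e1 $ i, e2 $ i:])"

lemma degree_coordinate_poly: "degree (coordinate_poly e1 e2 I) \<le> length I"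
proof (induction I)
  case (Cons i I)
  then show ?case
    using degree_mult_le[of "[:e1 $ i, e2 $ i:]" "coordinate_poly e1 e2 I"]
    by (simp add: coordinate_poly_def del: mult_pCons_left split: if_splits)
qed (simp add: coordinate_poly_def)

lemma poly_coordinate_poly:
  "poly (coordinate_poly e1 e2 I) s = elementary_tensor (replicate (length I) (e1 + s *s e2)) I"
  by (induction I) (auto simp: coordinate_poly_def algebra_simps)

text \<open>The W-state is the derivative at \<open>s = 0\<close> of the tensor power of \<open>e1 + s e2\<close>; both
  sides satisfy the product rule when an index is prepended.\<close>

lemma coeff_1_coordinate_poly: "coeff (coordinate_poly e1 e2 I) 1 = W_state e1 e2 (length I) I"
proof (induction I)
  case Nil
  then show ?case by (simp add: coordinate_poly_def W_state_def)
next
  case (Cons i I)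
  have "W_state e1 e2 (length (i # I)) (i # I)
    = e2 $ i * elementary_tensor (replicate (length I) e1) I
      + (\<Sum>j=1..length I. elementary_tensor (replicate j e1 @ [e2] @ replicate (length I - j) e1) (i # I))"
    unfolding W_state_def
    by (simp add: sum.atLeast_Suc_atMost sum.shift_bounds_cl_Suc_ivl del: sum.cl_ivl_Suc)
  also have "(\<Sum>j=1..length I. elementary_tensor (replicate j e1 @ [e2] @ replicate (length I - j) e1) (i # I))
    = e1 $ i * W_state e1 e2 (length I) I"
    unfolding W_state_def sum_distrib_left
  proof (rule sum.cong)
    fix j assume "j \<in> {1..length I}"
    then have "replicate j e1 = e1 # replicate (j - 1) e1" by (cases j) auto
    then show "elementary_tensor (replicate j e1 @ [e2] @ replicate (length I - j) e1) (i # I)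
      = e1 $ i * elementary_tensor (replicate (j - 1) e1 @ [e2] @ replicate (length I - j) e1) I"
      by simp
  qed simp
  also have "elementary_tensor (replicate (length I) e1) I = coeff (coordinate_poly e1 e2 I) 0"
    using poly_coordinate_poly[of e1 e2 I 0] by (simp add: poly_0_coeff_0)
  finally show ?case
    using Cons.IH by (simp add: coordinate_poly_def)
qed

primrec blocks :: "nat list \<Rightarrow> 'a list \<Rightarrow> 'a list list" where
  "blocks [] I = []"
| "blocks (d # ds) I = take d I # blocks ds (drop d I)"

lemma length_blocks:
  "length I = sum_list ds \<Longrightarrow> list_all2 (\<lambda>J d. length J = d) (blocks ds I) ds"
  by (induction ds arbitrary: I) auto

lemma W_product_eq_prod_coeff:
  "length I = sum_list ds \<Longrightarrow>
    W_product e1 e2 ds I = (\<Prod>J\<leftarrow>blocks ds I. coeff (coordinate_poly e1 e2 J) 1)"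
proof (induction ds arbitrary: I)
  case (Cons d ds)
  then show ?case by (simp add: tensor_mult_def coeff_1_coordinate_poly flip: One_nat_def)
qed simp

definition powers_product :: "complex ^ 2 \<Rightarrow> complex ^ 2 \<Rightarrow> nat list \<Rightarrow> complex list \<Rightarrow> (complex ^ 2) list" where
  "powers_product e1 e2 ds ss = concat (map2 (\<lambda>d s. replicate d (e1 + s *s e2)) ds ss)"

lemma length_powers_product:
  "length ss = length ds \<Longrightarrow> length (powers_product e1 e2 ds ss) = sum_list ds"
  unfolding powers_product_def by (induction ss ds rule: list_induct2) auto

lemma elementary_tensor_powers_product:
  assumes "length ds = length ss" "length I = sum_list ds"
  shows "elementary_tensor (powers_product e1 e2 ds ss) I
    = prod_list (map2 (\<lambda>J s. poly (coordinate_poly e1 e2 J) s) (blocks ds I) ss)"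
  using assms
proof (induction ds ss arbitrary: I rule: list_induct2)
  case Nil
  then show ?case by (simp add: powers_product_def)
next
  case (Cons d ds s ss)
  let ?u = "replicate d (e1 + s *s e2)"
  have "elementary_tensor (powers_product e1 e2 (d # ds) (s # ss)) I
    = tensor_mult (length ?u) (elementary_tensor ?u) (elementary_tensor (powers_product e1 e2 ds ss)) I"
    unfolding tensor_mult_elementary by (simp add: powers_product_def)
  then show ?case
    using Cons.IH[of "drop d I"] Cons.prems
    by (simp add: tensor_mult_def poly_coordinate_poly)
qed

section \<open>Rank bounds\<close>

text \<open>Over a nonempty list of vectors a scalar weight can be absorbed into the first vector, so a
  linear combination of elementary tensors costs no more than a sum.\<close>

lemma tensor_rank_le_card:
  assumes "finite X" "0 < n" and len: "\<And>x. x \<in> X \<Longrightarrow> length (v x) = n"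
    and T: "\<And>I. T I = (\<Sum>x\<in>X. w x * elementary_tensor (v x) I)"
  shows "tensor_rank n T \<le> card X"
proof -
  obtain h where h: "bij_betw h {..<card X} X"
    using ex_bij_betw_nat_finite[OF assms(1)] by (auto simp: lessThan_atLeast0)
  define V where "V x = (w x *s hd (v x)) # tl (v x)" for x
  have V: "elementary_tensor (V x) I = w x * elementary_tensor (v x) I" "length (V x) = n"
    if x: "x \<in> X" for x I
  proof -
    obtain a us where v: "v x = a # us" using len[OF x] assms(2) by (cases "v x") auto
    show "length (V x) = n" using len[OF x] v by (simp add: V_def)
    show "elementary_tensor (V x) I = w x * elementary_tensor (v x) I"
      using v by (cases I) (simp_all add: V_def)
  qed
  have "T I = (\<Sum>s<card X. elementary_tensor (V (h s)) I)" for I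
    unfolding T sum.reindex_bij_betw[OF h, of "\<lambda>x. elementary_tensor (V x) I"]
    by (rule sum.cong) (simp_all add: V)
  moreover have "\<forall>s<card X. length (V (h s)) = n"
    using V(2) h by (auto simp: bij_betw_def)
  ultimately have "is_sum_of_elementary n (card X) T"
    unfolding is_sum_of_elementary_def by (intro exI[of _ "\<lambda>s. V (h s)"]) auto
  then show ?thesis unfolding tensor_rank_def by (rule Least_le)
qed

text \<open>Each coordinate of the product of W-states is a product of linear coefficients, to which
  the cubature rule applies with nodes and weights common to all coordinates; so each node
  contributes one elementary tensor.\<close>

lemma tensor_rank_W_product_le:
  assumes N: "N + 2 * length ds = d + sum_list ds" "length ds + 1 < N"
    and pos: "\<forall>d\<in>set ds. 0 < d"
  shows "tensor_rank (sum_list (d # ds)) (W_product e1 e2 (d # ds)) \<le> 2 ^ length ds * N"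
proof -
  obtain w z :: "complex list \<times> nat \<Rightarrow> complex" where cubature:
    "\<And>q ps. degree q \<le> d \<Longrightarrow> list_all2 (\<lambda>p d. degree p \<le> d) ps ds \<Longrightarrow>
      coeff q 1 * (\<Prod>p\<leftarrow>ps. coeff p 1)
        = (\<Sum>x\<in>signs (length ds) \<times> {..<N}. w x *
            (poly q (z x) * prod_list (map2 (\<lambda>p e. poly p (e * z x)) ps (fst x))))"
    using linear_coeff_cubature[OF assms] by blast
  define X where "X = signs (length ds) \<times> {..<N}"
  define v where "v x = powers_product e1 e2 (d # ds) (z x # map (\<lambda>e. e * z x) (fst x))" for x
  have len: "length (v x) = sum_list (d # ds)" if "x \<in> X" for x
    using that unfolding v_def X_def by (intro length_powers_product) (auto simp: signs_def)
  have "W_product e1 e2 (d # ds) I = (\<Sum>x\<in>X. w x * elementary_tensor (v x) I)" for I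
  proof (cases "length I = sum_list (d # ds)")
    case True
    let ?q = "coordinate_poly e1 e2 (take d I)"
    let ?Js = "blocks ds (drop d I)"
    have "degree ?q \<le> d"
      using degree_coordinate_poly[of e1 e2 "take d I"] True by simp
    moreover have "list_all2 (\<lambda>p d. degree p \<le> d) (map (coordinate_poly e1 e2) ?Js) ds"
      unfolding list_all2_map1
      by (rule list_all2_mono[OF length_blocks]) (use True degree_coordinate_poly in auto)
    ultimately have "coeff ?q 1 * (\<Prod>p\<leftarrow>map (coordinate_poly e1 e2) ?Js. coeff p 1)
      = (\<Sum>x\<in>X. w x * (poly ?q (z x)
          * prod_list (map2 (\<lambda>p e. poly p (e * z x)) (map (coordinate_poly e1 e2) ?Js) (fst x))))"
      unfolding X_def by (rule cubature)
    also have "\<dots> = (\<Sum>x\<in>X. w x * elementary_tensor (v x) I)"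
    proof (intro sum.cong refl arg_cong2[where f = "(*)"])
      fix x assume "x \<in> X"
      then have "length (fst x) = length ds" by (auto simp: X_def signs_def)
      then show "poly ?q (z x) * prod_list (map2 (\<lambda>p e. poly p (e * z x))
          (map (coordinate_poly e1 e2) ?Js) (fst x)) = elementary_tensor (v x) I"
        unfolding v_def using True
        by (subst elementary_tensor_powers_product)
          (simp_all add: zip_map1 zip_map2 o_def case_prod_unfold)
    qed
    finally show ?thesis
      by (simp only: W_product_eq_prod_coeff[OF True]) (simp add: o_def)
  next
    case False
    have "W_product e1 e2 (d # ds) I = 0"
      using W_product_in_space[of e1 e2 "d # ds"] False unfolding tensor_space_def by blast
    moreover have "elementary_tensor (v x) I = 0" if "x \<in> X" for x
      using len[OF that] False by (simp add: elementary_tensor_def)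
    ultimately show ?thesis by simp
  qed
  moreover have "finite X" by (simp add: X_def finite_signs)
  moreover have "0 < sum_list (d # ds)" using N unfolding sum_list.Cons by linarith
  ultimately have "tensor_rank (sum_list (d # ds)) (W_product e1 e2 (d # ds)) \<le> card X"
    using len by (intro tensor_rank_le_card)
  then show ?thesis by (simp add: X_def card_cartesian_product card_signs)
qed

theorem corollary1p2:
  fixes e1 e2 :: "complex ^ 2" and k :: nat and ds :: "nat list"
  assumes "e1 \<noteq> e2" and "vec.independent {e1, e2}" and "vec.span {e1, e2} = UNIV"
    and "k \<ge> 2" and "length ds = k" and "\<forall>d\<in>set ds. d \<ge> 3"
  shows "int (tensor_rank (sum_list ds) (W_product e1 e2 ds))
           \<le> 2 ^ (k - 1) * (int (sum_list ds) - 2 * int k + 2)"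
proof -
  obtain d ds' where ds: "ds = d # ds'" using assms(4,5) by (cases ds) auto
  define N where "N = d + sum_list ds' - 2 * length ds'"
  have "3 * length xs \<le> sum_list xs" if "\<forall>d\<in>set xs. d \<ge> 3" for xs :: "nat list"
    using that by (induction xs) auto
  from this[of ds'] have big: "3 * length ds' \<le> sum_list ds'" and d: "3 \<le> d"
    using assms(6) ds by auto
  have N: "N + 2 * length ds' = d + sum_list ds'" "length ds' + 1 < N"
    using big d unfolding N_def by linarith+
  have pos: "\<forall>d\<in>set ds'. 0 < d" using assms(6) ds by auto
  have "int (tensor_rank (sum_list ds) (W_product e1 e2 ds)) \<le> int (2 ^ length ds' * N)"
    unfolding ds of_nat_le_iff by (rule tensor_rank_W_product_le[OF N pos])
  also have "\<dots> = 2 ^ length ds' * int N" by simp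
  also have "int N = int (sum_list ds) - 2 * int k + 2"
    using N(1) ds assms(5) by auto
  also have "length ds' = k - 1" using ds assms(5) by auto
  finally show ?thesis .
qed

end
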